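(* Fix constants $k,\rho,c,\lambda,\Theta_\infty>0$ (hence $\alpha=\frac{k}{\rho c}$ and $\mathrm{Ste}=\frac{c\Theta_\infty}{\lambda}>0$). For $h>0$ let $\mathrm{Bi}=\frac{h\sqrt{\alpha}}{k}$ and let $(T_2,s_2)$, depending on $\mathrm{Bi}$, be the quadratic-profile solution of Problem (P2); let $(T_{2\infty},s_{2\infty})$ be the quadratic-profile solution of Problem (P2$_\infty$). Then the solution of (P2) converges to the solution of (P2$_\infty$) as $\mathrm{Bi}\to\infty$, that is, $$T_2(x,t)\to T_{2\infty}(x,t)\quad\text{and}\quad s_2(t)\to s_{2\infty}(t)\quad\text{when }\mathrm{Bi}\to\infty,$$ for every $t>0$ and $0<x<s_{2\infty}(t)$.
   Context: Problem (P2): find $s_2(t)$ and $T_2(x,t)$, $0\le x\le s_2(t)$, $t>0$, such that for all $t>0$: $\frac{d}{dt}\int_{0}^{s_{2}(t)}T_{2}(x,t)\,dx=\frac{k}{\rho c}\left[\frac{\rho\lambda}{k}\dot{s}_{2}(t)-\frac{\partial T_2}{\partial x}(0,t)\right]$; $k\frac{\partial T_2}{\partial x}(0,t)=\frac{h}{\sqrt{t}}(T_{2}(0,t)+\Theta_{\infty})$; $T_{2}(s_{2}(t),t)=0$; $k\frac{\partial T_2}{\partial x}(s_{2}(t),t)=\rho\lambda\dot{s}_2(t)$; and $s_{2}(0)=0$. Problem (P2$_\infty$) is the same problem for $(T_{2\infty},s_{2\infty})$ with the second condition (the convective one) replaced by $T_{2\infty}(0,t)=-\Theta_\infty$, $t>0$.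 A quadratic-profile solution of either problem is one of the form $T(x,t)=-A\Theta_\infty\left(1-\frac{x}{s(t)}\right)-B\Theta_\infty\left(1-\frac{x}{s(t)}\right)^2$ with constants $A>0$, $B>0$. Each problem has exactly one such solution, and explicitly: (P2): $s_2(t)=2\xi_2\sqrt{\alpha t}$, $A=A_2=\frac{6\mathrm{Ste}-(6+2\mathrm{Ste})\xi_{2}^{2}-\frac{6}{\mathrm{Bi}}\xi_{2}}{\mathrm{Ste}(\xi_{2}^{2}+\frac{2}{\mathrm{Bi}}\xi_{2}+3)}$, $B=B_2=\frac{(3\mathrm{Ste}+6)\xi_{2}^{2}+\frac{3}{\mathrm{Bi}}\xi_{2}-3\mathrm{Ste}}{\mathrm{Ste}(\xi_{2}^{2}+\frac{2}{\mathrm{Bi}}\xi_{2}+3)}$, where $\xi_2$ is the unique solution in $(\xi^{\min},\xi^{\max})$ of $$z^{4}+\tfrac{2}{\mathrm{Bi}}z^{3}+(6+\mathrm{Ste})z^{2}+\tfrac{3}{\mathrm{Bi}}z-3\mathrm{Ste}=0,$$ with $\xi^{\min}=\frac{\sqrt{4\mathrm{Ste}^2+8\mathrm{Ste}+1/\mathrm{Bi}^2}-1/\mathrm{Bi}}{2(2+\mathrm{Ste})}$ and $\xi^{\max}=\frac{\sqrt{12\mathrm{Ste}^2+36\mathrm{Ste}+9/\mathrm{Bi}^2}-3/\mathrm{Bi}}{2(3+\mathrm{Ste})}$. (P2$_\infty$): $s_{2\infty}(t)=2\xi_{2\infty}\sqrt{\alpha t}$, $\xi_{2\infty}=\left(\frac{\sqrt{(6+\mathrm{Ste})^2+12\mathrm{Ste}}-(6+\mathrm{Ste})}{2}\right)^{1/2}$,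 $A=A_{2\infty}=-\frac{2(\mathrm{Ste}+3)}{\mathrm{Ste}}+\frac{12(2\mathrm{Ste}+3)}{\mathrm{Ste}\left(\sqrt{\mathrm{Ste}^2+24\mathrm{Ste}+36}-\mathrm{Ste}\right)}$, $B=B_{2\infty}=\frac{3(\mathrm{Ste}+2)}{\mathrm{Ste}}-\frac{12(2\mathrm{Ste}+3)}{\mathrm{Ste}\left(\sqrt{\mathrm{Ste}^2+24\mathrm{Ste}+36}-\mathrm{Ste}\right)}$. *)

theory Defs
  imports "HOL-Analysis.Analysis"
begin

text \<open>
  The unknowns are the temperature \<open>T x t\<close>, relevant for \<open>t > 0\<close> and \<open>0 \<le> x \<le> s t\<close> only, and the
  free boundary \<open>s\<close>. The values \<open>T x t\<close> for \<open>x\<close> outside \<open>{0..s t}\<close> are arbitrary, so the spatial derivative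
  \<open>Tx\<close> is taken within that interval, that is, one-sidedly at the two boundary points; its existence
  makes \<open>T\<close> continuous, hence integrable, in \<open>x\<close>. The continuity of \<open>s\<close> on \<open>{0..}\<close> is what gives
  the initial condition \<open>s 0 = 0\<close> its meaning, the differential conditions being imposed for
  \<open>t > 0\<close> only.
\<close>

definition stefan_common ::
  "real \<Rightarrow> real \<Rightarrow> real \<Rightarrow> real \<Rightarrow> (real \<Rightarrow> real \<Rightarrow> real) \<Rightarrow> (real \<Rightarrow> real)
    \<Rightarrow> (real \<Rightarrow> real \<Rightarrow> real) \<Rightarrow> (real \<Rightarrow> real) \<Rightarrow> bool" where
  "stefan_common k \<rho> c lam T s Tx s' \<longleftrightarrow>
     continuous_on {0..} s \<and> s 0 = 0 \<and>
     (\<forall>t>0. s t > 0 \<and>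
        (s has_real_derivative s' t) (at t) \<and>
        (\<forall>x\<in>{0..s t}. ((\<lambda>y. T y t) has_real_derivative Tx x t) (at x within {0..s t})) \<and>
        ((\<lambda>\<tau>. integral {0..s \<tau>} (\<lambda>x. T x \<tau>)) has_real_derivative
           k / (\<rho> * c) * (\<rho> * lam / k * s' t - Tx 0 t)) (at t) \<and>
        T (s t) t = 0 \<and>
        k * Tx (s t) t = \<rho> * lam * s' t)"

definition problem_P2 ::
  "real \<Rightarrow> real \<Rightarrow> real \<Rightarrow> real \<Rightarrow> real \<Rightarrow> real \<Rightarrow> (real \<Rightarrow> real \<Rightarrow> real) \<Rightarrow> (real \<Rightarrow> real) \<Rightarrow> bool" where
  "problem_P2 k \<rho> c lam \<Theta> h T s \<longleftrightarrow>
     (\<exists>Tx s'. stefan_common k \<rho> c lam T s Tx s' \<and>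
        (\<forall>t>0. k * Tx 0 t = h / sqrt t * (T 0 t + \<Theta>)))"

definition problem_P2_inf ::
  "real \<Rightarrow> real \<Rightarrow> real \<Rightarrow> real \<Rightarrow> real \<Rightarrow> (real \<Rightarrow> real \<Rightarrow> real) \<Rightarrow> (real \<Rightarrow> real) \<Rightarrow> bool" where
  "problem_P2_inf k \<rho> c lam \<Theta> T s \<longleftrightarrow>
     (\<exists>Tx s'. stefan_common k \<rho> c lam T s Tx s' \<and>
        (\<forall>t>0. T 0 t = - \<Theta>))"

text \<open>\<open>A\<close> and \<open>B\<close> depend on neither \<open>x\<close> nor \<open>t\<close>.\<close>

definition quadratic_profile :: "real \<Rightarrow> (real \<Rightarrow> real \<Rightarrow> real) \<Rightarrow> (real \<Rightarrow> real) \<Rightarrow> bool" where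
  "quadratic_profile \<Theta> T s \<longleftrightarrow>
     (\<exists>A>0. \<exists>B>0. \<forall>t>0. \<forall>x\<in>{0..s t}.
        T x t = - A * \<Theta> * (1 - x / s t) - B * \<Theta> * (1 - x / s t)\<^sup>2)"

definition diffusivity :: "real \<Rightarrow> real \<Rightarrow> real \<Rightarrow> real" where
  "diffusivity k \<rho> c = k / (\<rho> * c)"

definition biot :: "real \<Rightarrow> real \<Rightarrow> real \<Rightarrow> real \<Rightarrow> real" where
  "biot k \<rho> c h = h * sqrt (diffusivity k \<rho> c) / k"

end

theory Submission imports Defs begin

text \<open>
  For a quadratic profile the Stefan condition at the free boundary reads
  \<open>(s\<^sup>2)' = 2 \<alpha> Ste A\<close>, so \<open>s t = sqrt (2 Ste A \<alpha> t)\<close>, and the heat balance becomes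
  \<open>Ste A (3 A + 2 B) = 12 B\<close>. This last relation makes \<open>B\<close> an increasing function of \<open>A\<close>. The
  boundary condition at \<open>x = 0\<close> is \<open>A + B = 1\<close> for the limit problem and
  \<open>A + 2 B = sqrt (2 Ste A) Bi (1 - A - B)\<close> for the convective one. Hence both convective coefficients
  stay below the limiting ones, their total defect is \<open>1 - A - B\<close>, and this is \<open>O(1 / Bi)\<close>.
\<close>

lemma quadratic_profile_has_derivative:
  fixes A B \<Theta> S x :: real
  assumes "S > 0"
  shows "((\<lambda>y. - A * \<Theta> * (1 - y / S) - B * \<Theta> * (1 - y / S)\<^sup>2) has_real_derivative
           A * \<Theta> / S + 2 * B * \<Theta> / S * (1 - x / S)) (at x within X)"
  using assms by (auto intro!: derivative_eq_intros simp: field_simps eval_nat_numeral)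

lemma quadratic_profile_integral:
  fixes A B \<Theta> S :: real
  assumes "S > 0"
  shows "integral {0..S} (\<lambda>y. - A * \<Theta> * (1 - y / S) - B * \<Theta> * (1 - y / S)\<^sup>2)
           = - \<Theta> * (A / 2 + B / 3) * S"
proof -
  \<comment> \<open>The square is integrated in the variable \<open>1 - y / S\<close>; the inner
    derivative \<open>- 1 / S\<close> accounts for the factor \<open>S / 3\<close> and for the
    change of sign.\<close>
  define F where "F y = - A * \<Theta> * (y - y\<^sup>2 / (2 * S)) + B * \<Theta> * S / 3 * (1 - y / S)^3" for y
  have "((\<lambda>y. - A * \<Theta> * (1 - y / S) - B * \<Theta> * (1 - y / S)\<^sup>2) has_integral (F S - F 0)) {0..S}"
  proof (rule fundamental_theorem_of_calculus)
    show "0 \<le> S" using assms by simp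
    fix y assume "y \<in> {0..S}"
    have "(F has_real_derivative - A * \<Theta> * (1 - y / S) - B * \<Theta> * (1 - y / S)\<^sup>2)
            (at y within {0..S})"
      unfolding F_def using assms
      by (auto intro!: derivative_eq_intros simp: divide_simps)
        (auto simp: algebra_simps eval_nat_numeral)
    then show "(F has_vector_derivative - A * \<Theta> * (1 - y / S) - B * \<Theta> * (1 - y / S)\<^sup>2)
            (at y within {0..S})"
      by (simp add: has_real_derivative_iff_has_vector_derivative)
  qed
  moreover have "F S - F 0 = - \<Theta> * (A / 2 + B / 3) * S"
    unfolding F_def using assms by (simp add: field_simps power2_eq_square)
  ultimately show ?thesis by (simp add: integral_unique)
qed

text \<open>This collects what both problems share, before the condition at \<open>x = 0\<close>
  enters. The fluxes at both ends are constants divided by \<open>s\<close>, and the integral is a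
  constant times \<open>s\<close>. Multiplying the heat balance by \<open>s\<close> therefore leaves
  only the product \<open>s * s'\<close>, which the Stefan condition makes constant, and a relation
  between \<open>A\<close>, \<open>B\<close> and \<open>Ste\<close> remains.\<close>

lemma stefan_quadratic_profile:
  fixes k \<rho> c lam \<Theta> A B Ste :: real
  assumes pos: "k > 0" "\<rho> > 0" "c > 0" "lam > 0" "\<Theta> > 0"
    and A: "A > 0"
    and Ste: "Ste = c * \<Theta> / lam"
    and stefan: "stefan_common k \<rho> c lam T s Tx s'"
    and profile: "\<forall>t>0. \<forall>x\<in>{0..s t}.
        T x t = - A * \<Theta> * (1 - x / s t) - B * \<Theta> * (1 - x / s t)\<^sup>2"
  shows "\<And>t. t > 0 \<Longrightarrow> s t = sqrt (2 * Ste * A) * sqrt (diffusivity k \<rho> c * t)"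
    and "\<And>t. t > 0 \<Longrightarrow> Tx 0 t = \<Theta> * (A + 2 * B) / s t"
    and "Ste * A * (3 * A + 2 * B) = 12 * B"
proof -
  define a where "a = diffusivity k \<rho> c"
  have a: "a > 0" "a = k / (\<rho> * c)" using pos by (auto simp: a_def diffusivity_def)
  have cont: "continuous_on {0..} s" and s0: "s 0 = 0"
    using stefan by (auto simp: stefan_common_def)
  have s_pos: "s t > 0" and ds: "(s has_real_derivative s' t) (at t)"
    and dT: "\<And>x. x \<in> {0..s t} \<Longrightarrow> ((\<lambda>y. T y t) has_real_derivative Tx x t) (at x within {0..s t})"
    and balance: "((\<lambda>\<tau>. integral {0..s \<tau>} (\<lambda>x. T x \<tau>)) has_real_derivative
           k / (\<rho> * c) * (\<rho> * lam / k * s' t - Tx 0 t)) (at t)"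
    and front: "k * Tx (s t) t = \<rho> * lam * s' t" if "t > 0" for t
    using stefan that by (auto simp: stefan_common_def)
  \<comment> \<open>\<open>Tx\<close> is only given as some derivative within
    \<open>{0..s t}\<close>. Since \<open>s t > 0\<close>, every point of this interval is a limit
    point of it, so such derivatives are unique, also at the ends.\<close>
  have Tx: "Tx x t = A * \<Theta> / s t + 2 * B * \<Theta> / s t * (1 - x / s t)"
    if "t > 0" "x \<in> {0..s t}" for x t
  proof -
    have "((\<lambda>y. T y t) has_real_derivative A * \<Theta> / s t + 2 * B * \<Theta> / s t * (1 - x / s t))
            (at x within {0..s t})"
      using quadratic_profile_has_derivative[OF s_pos[OF \<open>t > 0\<close>]]
      by (rule has_field_derivative_transform_within[where d = 1])
        (use that profile in auto)
    moreover have "at x within {0..s t} \<noteq> bot"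
      using that s_pos[OF \<open>t > 0\<close>] by (simp add: trivial_limit_within)
    ultimately show ?thesis using dT[OF that] by (blast intro: has_field_derivative_unique)
  qed
  show Tx0: "Tx 0 t = \<Theta> * (A + 2 * B) / s t" if "t > 0" for t
    using Tx[OF that, of 0] s_pos[OF that] by (simp add: field_simps)
  have ss': "s t * s' t = a * Ste * A" if "t > 0" for t
    using front[OF that] Tx[OF that, of "s t"] s_pos[OF that] pos
    by (simp add: Ste a field_simps)
  \<comment> \<open>For positive times the derivative of \<open>s\<^sup>2\<close> is constant by
    \<open>ss'\<close>; continuity of \<open>s\<close> at 0 brings in the initial value
    \<open>s 0 = 0\<close>.\<close>
  have s_sq: "(s t)\<^sup>2 = 2 * Ste * A * (a * t)" if "t > 0" for t
  proof -
    have "(\<lambda>t. (s t)\<^sup>2 - 2 * Ste * A * (a * t)) t = (\<lambda>t. (s t)\<^sup>2 - 2 * Ste * A * (a * t)) 0"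
    proof (rule DERIV_isconst_end[OF that])
      show "continuous_on {0..t} (\<lambda>t. (s t)\<^sup>2 - 2 * Ste * A * (a * t))"
        by (intro continuous_intros continuous_on_subset[OF cont]) auto
      fix u :: real assume "0 < u" "u < t"
      then show "((\<lambda>t. (s t)\<^sup>2 - 2 * Ste * A * (a * t)) has_real_derivative 0) (at u)"
        using ss'[of u] by (auto intro!: derivative_eq_intros ds simp: algebra_simps)
    qed
    then show ?thesis using s0 by simp
  qed
  show "s t = sqrt (2 * Ste * A) * sqrt (diffusivity k \<rho> c * t)" if "t > 0" for t
    using s_sq[OF that] s_pos[OF that]
    by (metis a_def less_eq_real_def real_sqrt_mult real_sqrt_unique)
  \<comment> \<open>A relation between constants can be read off at a single time, here 1;
    \<open>{0<..}\<close> is an open neighbourhood of it on which the profile is known.\<close>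
  have "((\<lambda>\<tau>. integral {0..s \<tau>} (\<lambda>x. T x \<tau>)) has_real_derivative - \<Theta> * (A / 2 + B / 3) * s' 1) (at 1)"
  proof (rule has_field_derivative_transform_within_open[where S = "{0<..}"])
    show "((\<lambda>\<tau>. - \<Theta> * (A / 2 + B / 3) * s \<tau>) has_real_derivative - \<Theta> * (A / 2 + B / 3) * s' 1) (at 1)"
      by (rule DERIV_cmult) (rule ds, simp)
    fix \<tau> :: real assume "\<tau> \<in> {0<..}"
    then have "\<tau> > 0" by simp
    have "integral {0..s \<tau>} (\<lambda>x. T x \<tau>)
        = integral {0..s \<tau>} (\<lambda>y. - A * \<Theta> * (1 - y / s \<tau>) - B * \<Theta> * (1 - y / s \<tau>)\<^sup>2)"
      using profile \<open>\<tau> > 0\<close> by (intro integral_cong) blast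
    then show "- \<Theta> * (A / 2 + B / 3) * s \<tau> = integral {0..s \<tau>} (\<lambda>x. T x \<tau>)"
      using quadratic_profile_integral[OF s_pos[OF \<open>\<tau> > 0\<close>]] by simp
  qed auto
  then have "- \<Theta> * (A / 2 + B / 3) * s' 1 = a * (\<rho> * lam / k * s' 1 - Tx 0 1)"
    using balance[of 1] DERIV_unique a(2) by fastforce
  moreover have Tx0_s: "\<Theta> * (A + 2 * B) = s 1 * Tx 0 1"
    using Tx0[of 1] s_pos[of 1] by simp
  ultimately have "- \<Theta> * (A / 2 + B / 3) * s' 1 * s 1 = a * (\<rho> * lam / k * s' 1 - Tx 0 1) * s 1"
    by simp
  then have "- \<Theta> * (A / 2 + B / 3) * (s 1 * s' 1)
      = a * (\<rho> * lam / k * (s 1 * s' 1) - \<Theta> * (A + 2 * B))"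
    by (simp add: algebra_simps flip: Tx0_s)
  \<comment> \<open>The latent heat term cancels the \<open>A\<close> part of the flux at
    \<open>x = 0\<close>, leaving \<open>- 2 * B\<close>; multiplication by -6 then gives
    \<open>12 * B\<close>.\<close>
  moreover have "\<rho> * lam / k * (a * Ste * A) = \<Theta> * A"
    using pos by (simp add: a Ste)
  ultimately have "- \<Theta> * (A / 2 + B / 3) * (a * Ste * A) = a * (\<Theta> * A - \<Theta> * (A + 2 * B))"
    using ss'[of 1] by simp
  then have "(a * \<Theta>) * (Ste * A * (3 * A + 2 * B)) = (a * \<Theta>) * (12 * B)"
    by (simp add: algebra_simps)
  then show "Ste * A * (3 * A + 2 * B) = 12 * B" using a pos by simp
qed

text \<open>Solved for \<open>B\<close>, the balance is
  \<open>B = 3 * Ste * A\<^sup>2 / (12 - 2 * Ste * A)\<close>, with positive denominator because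
  \<open>B > 0\<close>. A larger \<open>A\<close> raises the numerator and lowers the denominator.
  Replacing the denominator and one factor \<open>A\<close> by their values at \<open>A'\<close>
  bounds \<open>B\<close> linearly in \<open>A\<close>.\<close>

lemma heat_balance_mono:
  fixes A B A' B' Ste :: real
  assumes pos: "Ste > 0" "A > 0" "B > 0" "A' > 0" "B' > 0"
    and bal: "Ste * A * (3 * A + 2 * B) = 12 * B" "Ste * A' * (3 * A' + 2 * B') = 12 * B'"
    and le: "A \<le> A'"
  shows "B \<le> B'" and "(12 - 2 * Ste * A') * B \<le> 3 * Ste * A' * A" and "12 - 2 * Ste * A' > 0"
proof -
  have eq: "(12 - 2 * Ste * A) * B = 3 * Ste * A * A" "(12 - 2 * Ste * A') * B' = 3 * Ste * A' * A'"
    using bal by (simp_all add: algebra_simps)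
  have "(12 - 2 * Ste * A') * B' > 0" using eq(2) pos by simp
  then show d: "12 - 2 * Ste * A' > 0" using pos by (simp add: zero_less_mult_iff)
  have "(12 - 2 * Ste * A') * B \<le> (12 - 2 * Ste * A) * B"
    using pos le by (intro mult_right_mono) auto
  also have "\<dots> \<le> 3 * Ste * A' * A"
    unfolding eq using pos le by (intro mult_right_mono) auto
  finally show b: "(12 - 2 * Ste * A') * B \<le> 3 * Ste * A' * A" .
  also have "\<dots> \<le> 3 * Ste * A' * A'" using pos le by simp
  also have "\<dots> = (12 - 2 * Ste * A') * B'" using eq by simp
  finally show "B \<le> B'" using d by simp
qed

text \<open>The defect \<open>1 - A - B\<close> equals \<open>(A' - A) + (B' - B)\<close>, a sum of
  nonnegative terms, so its bound controls both. By the linear bound on \<open>B\<close>, the left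
  side of \<open>conv\<close> is of order \<open>A\<close>, that is, of order \<open>sqrt A\<close>
  squared; one root cancels against the right side. Thus a small \<open>A\<close> cannot spoil the
  estimate, and its constant depends on \<open>Ste\<close> and \<open>A'\<close> only.\<close>

lemma convective_coefficients_bound:
  fixes A B A' B' Ste Bi :: real
  assumes pos: "Ste > 0" "A > 0" "B > 0" "A' > 0" "B' > 0" "Bi > 0"
    and bal: "Ste * A * (3 * A + 2 * B) = 12 * B" "Ste * A' * (3 * A' + 2 * B') = 12 * B'"
    and conv: "A + 2 * B = sqrt (2 * Ste * A) * Bi * (1 - A - B)"
    and dirichlet: "A' + B' = 1"
  shows "A \<le> A'" and "B \<le> B'"
    and "1 - A - B
           \<le> (1 + 6 * Ste * A' / (12 - 2 * Ste * A')) * sqrt (2 * Ste * A') / (2 * Ste) / Bi"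
proof -
  define \<sigma> where "\<sigma> = sqrt (2 * Ste * A)"
  have \<sigma>: "\<sigma> > 0" "\<sigma>\<^sup>2 = 2 * Ste * A" using pos by (auto simp: \<sigma>_def)
  \<comment> \<open>A positive flux keeps the temperature at \<open>x = 0\<close> above
    \<open>- \<Theta>\<close>, hence \<open>A + B < 1\<close>. By monotonicity,
    \<open>A' \<le> A\<close> would force \<open>A + B \<ge> 1\<close>.\<close>
  have "\<sigma> * Bi * (1 - A - B) > 0" using conv pos unfolding \<sigma>_def by linarith
  then have lt1: "A + B < 1" using zero_less_mult_pos[of "\<sigma> * Bi" "1 - A - B"] \<sigma> pos by simp
  show le: "A \<le> A'"
  proof (rule ccontr)
    assume "\<not> A \<le> A'"
    then have "A' \<le> A" by simp
    then have "B' \<le> B" using heat_balance_mono(1) pos bal by blast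
    then show False using lt1 dirichlet \<open>A' \<le> A\<close> by linarith
  qed
  note mono = heat_balance_mono[OF pos(1-5) bal le]
  show "B \<le> B'" by (fact mono(1))
  \<comment> \<open>Chosen so that the linear bound on \<open>B\<close> reads
    \<open>A + 2 * B \<le> K * A\<close>.\<close>
  define K where "K = 1 + 6 * Ste * A' / (12 - 2 * Ste * A')"
  have K: "K > 0" using mono pos by (auto simp: K_def intro!: add_pos_pos divide_pos_pos)
  have "\<sigma> * (Bi * (1 - A - B)) = A + 2 * B" using conv by (simp add: \<sigma>_def)
  also have "\<dots> \<le> K * A" using mono pos by (simp add: K_def field_simps)
  also have "\<dots> = \<sigma> * (K * \<sigma> / (2 * Ste))"
    using \<sigma>(2) pos by (simp add: field_simps power2_eq_square)
  finally have "Bi * (1 - A - B) \<le> K * \<sigma> / (2 * Ste)"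
    using \<sigma>(1) by (rule mult_left_le_imp_le)
  also have "\<dots> \<le> K * sqrt (2 * Ste * A') / (2 * Ste)"
    using K pos le by (intro divide_right_mono mult_left_mono) (auto simp: \<sigma>_def)
  finally have "Bi * (1 - A - B) \<le> K * sqrt (2 * Ste * A') / (2 * Ste)" .
  then show "1 - A - B
      \<le> (1 + 6 * Ste * A' / (12 - 2 * Ste * A')) * sqrt (2 * Ste * A') / (2 * Ste) / Bi"
    using pos(6) unfolding K_def[symmetric] by (subst pos_le_divide_eq) (auto simp: mult.commute)
qed

text \<open>Both sides of the convective condition carry the factor \<open>1 / sqrt t\<close>, since
  \<open>s\<close> grows like \<open>sqrt t\<close>, so time 1 contains all its information. There
  the root of the diffusivity in \<open>s 1\<close> joins \<open>h / k\<close> to form the Biot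
  number.\<close>

lemma P2_quadratic_profile:
  fixes k \<rho> c lam \<Theta> h Ste :: real
  assumes pos: "k > 0" "\<rho> > 0" "c > 0" "lam > 0" "\<Theta> > 0"
    and Ste: "Ste = c * \<Theta> / lam"
    and P2: "problem_P2 k \<rho> c lam \<Theta> h T s" and quad: "quadratic_profile \<Theta> T s"
  obtains A B where "A > 0" "B > 0"
    "\<And>t x. t > 0 \<Longrightarrow> x \<in> {0..s t} \<Longrightarrow>
       T x t = - A * \<Theta> * (1 - x / s t) - B * \<Theta> * (1 - x / s t)\<^sup>2"
    "\<And>t. t > 0 \<Longrightarrow> s t = sqrt (2 * Ste * A) * sqrt (diffusivity k \<rho> c * t)"
    "Ste * A * (3 * A + 2 * B) = 12 * B"
    "A + 2 * B = sqrt (2 * Ste * A) * biot k \<rho> c h * (1 - A - B)"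
proof -
  obtain A B where AB: "A > 0" "B > 0" and profile: "\<forall>t>0. \<forall>x\<in>{0..s t}.
        T x t = - A * \<Theta> * (1 - x / s t) - B * \<Theta> * (1 - x / s t)\<^sup>2"
    using quad unfolding quadratic_profile_def by blast
  obtain Tx s' where stefan: "stefan_common k \<rho> c lam T s Tx s'"
    and conv: "\<And>t. t > 0 \<Longrightarrow> k * Tx 0 t = h / sqrt t * (T 0 t + \<Theta>)"
    using P2 unfolding problem_P2_def by blast
  note sol = stefan_quadratic_profile[OF pos AB(1) Ste stefan profile]
  have s1: "s 1 > 0" using stefan by (simp add: stefan_common_def)
  have "T 0 1 = - A * \<Theta> - B * \<Theta>" using profile[rule_format, of 1 0] s1 by simp
  then have "k * (\<Theta> * (A + 2 * B) / s 1) = h * (\<Theta> - A * \<Theta> - B * \<Theta>)"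
    using conv[of 1] sol(2)[of 1] by simp
  then have "\<Theta> * (k * (A + 2 * B)) = \<Theta> * (s 1 * h * (1 - A - B))"
    using s1 by (simp add: field_simps)
  then have "k * (A + 2 * B) = s 1 * h * (1 - A - B)" using pos by simp
  then have "A + 2 * B = sqrt (2 * Ste * A) * biot k \<rho> c h * (1 - A - B)"
    using pos sol(1)[of 1] by (simp add: biot_def field_simps)
  with AB profile sol that show ?thesis by blast
qed

lemma P2_inf_quadratic_profile:
  fixes k \<rho> c lam \<Theta> Ste :: real
  assumes pos: "k > 0" "\<rho> > 0" "c > 0" "lam > 0" "\<Theta> > 0"
    and Ste: "Ste = c * \<Theta> / lam"
    and P2: "problem_P2_inf k \<rho> c lam \<Theta> T s" and quad: "quadratic_profile \<Theta> T s"
  obtains A B where "A > 0" "B > 0"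
    "\<And>t x. t > 0 \<Longrightarrow> x \<in> {0..s t} \<Longrightarrow>
       T x t = - A * \<Theta> * (1 - x / s t) - B * \<Theta> * (1 - x / s t)\<^sup>2"
    "\<And>t. t > 0 \<Longrightarrow> s t = sqrt (2 * Ste * A) * sqrt (diffusivity k \<rho> c * t)"
    "Ste * A * (3 * A + 2 * B) = 12 * B"
    "A + B = 1"
proof -
  obtain A B where AB: "A > 0" "B > 0" and profile: "\<forall>t>0. \<forall>x\<in>{0..s t}.
        T x t = - A * \<Theta> * (1 - x / s t) - B * \<Theta> * (1 - x / s t)\<^sup>2"
    using quad unfolding quadratic_profile_def by blast
  obtain Tx s' where stefan: "stefan_common k \<rho> c lam T s Tx s'" and bc: "T 0 1 = - \<Theta>"
    using P2 unfolding problem_P2_inf_def by auto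
  note sol = stefan_quadratic_profile[OF pos AB(1) Ste stefan profile]
  have "s 1 > 0" using stefan by (simp add: stefan_common_def)
  then have "T 0 1 = - \<Theta> * (A + B)"
    using profile[rule_format, of 1 0] by (simp add: algebra_simps)
  then have "A + B = 1" using bc pos by simp
  with AB profile sol that show ?thesis by blast
qed

theorem theorem4p4:
  fixes k \<rho> c lam \<Theta> :: real
    and T2 :: "real \<Rightarrow> real \<Rightarrow> real \<Rightarrow> real" and s2 :: "real \<Rightarrow> real \<Rightarrow> real"
    and T2inf :: "real \<Rightarrow> real \<Rightarrow> real" and s2inf :: "real \<Rightarrow> real"
  assumes "k > 0" "\<rho> > 0" "c > 0" "lam > 0" "\<Theta> > 0"
    and "\<And>h. h > 0 \<Longrightarrow> problem_P2 k \<rho> c lam \<Theta> h (T2 (biot k \<rho> c h)) (s2 (biot k \<rho> c h))"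
    and "\<And>h. h > 0 \<Longrightarrow> quadratic_profile \<Theta> (T2 (biot k \<rho> c h)) (s2 (biot k \<rho> c h))"
    and "problem_P2_inf k \<rho> c lam \<Theta> T2inf s2inf"
    and "quadratic_profile \<Theta> T2inf s2inf"
  shows "\<forall>t>0. \<forall>x. 0 < x \<and> x < s2inf t \<longrightarrow>
           ((\<lambda>Bi. T2 Bi x t) \<longlongrightarrow> T2inf x t) at_top \<and>
           ((\<lambda>Bi. s2 Bi t) \<longlongrightarrow> s2inf t) at_top"
proof -
  note pos = assms(1-5)
  define Ste where "Ste = c * \<Theta> / lam"
  define a where "a = diffusivity k \<rho> c"
  have Ste: "Ste > 0" and a: "a > 0" using pos by (auto simp: Ste_def a_def diffusivity_def)
  \<comment> \<open>All facts about one pair of coefficients are bundled, so that a single choice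
    yields \<open>A\<close> and \<open>B\<close> as functions of \<open>Bi\<close>.\<close>
  define sol where "sol Bi A B \<longleftrightarrow> A > 0 \<and> B > 0 \<and>
      (\<forall>t x. t > 0 \<longrightarrow> x \<in> {0..s2 Bi t} \<longrightarrow>
         T2 Bi x t = - A * \<Theta> * (1 - x / s2 Bi t) - B * \<Theta> * (1 - x / s2 Bi t)\<^sup>2) \<and>
      (\<forall>t>0. s2 Bi t = sqrt (2 * Ste * A) * sqrt (a * t)) \<and>
      Ste * A * (3 * A + 2 * B) = 12 * B \<and>
      A + 2 * B = sqrt (2 * Ste * A) * Bi * (1 - A - B)" for Bi A B
  have "\<exists>A B. sol Bi A B" if "Bi > 0" for Bi
  proof -
    \<comment> \<open>This inverts \<open>biot\<close>, so every positive \<open>Bi\<close> is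
      reached.\<close>
    define h where "h = Bi * k / sqrt a"
    have h: "h > 0" "biot k \<rho> c h = Bi" using that pos a by (auto simp: h_def biot_def a_def)
    obtain A B where "sol Bi A B"
      by (rule P2_quadratic_profile[OF pos Ste_def assms(6)[OF h(1)] assms(7)[OF h(1)]])
        (unfold sol_def h(2) a_def, blast)
    then show ?thesis by blast
  qed
  then obtain A B where sol: "\<And>Bi. Bi > 0 \<Longrightarrow> sol Bi (A Bi) (B Bi)"
    by metis
  have AB: "A Bi > 0" "B Bi > 0"
    and T2: "\<And>t x. t > 0 \<Longrightarrow> x \<in> {0..s2 Bi t} \<Longrightarrow>
      T2 Bi x t = - A Bi * \<Theta> * (1 - x / s2 Bi t) - B Bi * \<Theta> * (1 - x / s2 Bi t)\<^sup>2"
    and s2: "\<And>t. t > 0 \<Longrightarrow> s2 Bi t = sqrt (2 * Ste * A Bi) * sqrt (a * t)"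
    and bal: "Ste * A Bi * (3 * A Bi + 2 * B Bi) = 12 * B Bi"
    and conv: "A Bi + 2 * B Bi = sqrt (2 * Ste * A Bi) * Bi * (1 - A Bi - B Bi)"
    if "Bi > 0" for Bi
    using sol[OF that] unfolding sol_def by blast+
  obtain A' B' where AB': "A' > 0" "B' > 0"
    and T2inf: "\<And>t x. t > 0 \<Longrightarrow> x \<in> {0..s2inf t} \<Longrightarrow>
      T2inf x t = - A' * \<Theta> * (1 - x / s2inf t) - B' * \<Theta> * (1 - x / s2inf t)\<^sup>2"
    and s2inf: "\<And>t. t > 0 \<Longrightarrow> s2inf t = sqrt (2 * Ste * A') * sqrt (a * t)"
    and bal': "Ste * A' * (3 * A' + 2 * B') = 12 * B'" and sum1: "A' + B' = 1"
    using P2_inf_quadratic_profile[OF pos Ste_def assms(8,9)] unfolding a_def by blast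
  define K where "K = (1 + 6 * Ste * A' / (12 - 2 * Ste * A')) * sqrt (2 * Ste * A') / (2 * Ste)"
  have bound: "A Bi \<le> A'" "B Bi \<le> B'" "1 - A Bi - B Bi \<le> K / Bi" if "Bi > 0" for Bi
    using convective_coefficients_bound
      [OF Ste AB(1)[OF that] AB(2)[OF that] AB' that bal[OF that] bal' conv[OF that] sum1]
    unfolding K_def by auto
  have K_lim: "((\<lambda>Bi::real. L - K / Bi) \<longlongrightarrow> L) at_top" for L
    by (rule tendsto_eq_intros refl tendsto_divide_0 filterlim_at_top_imp_at_infinity
        filterlim_ident | simp)+
  \<comment> \<open>Since \<open>B Bi \<le> B'\<close> and \<open>A' + B' = 1\<close>, the gap
    \<open>A' - A Bi\<close> is at most the total defect, hence at most \<open>K / Bi\<close>; the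
    gap for \<open>B\<close> is treated in the same way.\<close>
  have A_lim: "(A \<longlongrightarrow> A') at_top"
  proof (rule tendsto_sandwich[OF _ _ K_lim tendsto_const])
    show "\<forall>\<^sub>F Bi in at_top. A' - K / Bi \<le> A Bi"
      using eventually_gt_at_top[of 0] by eventually_elim (use bound sum1 in force)
    show "\<forall>\<^sub>F Bi in at_top. A Bi \<le> A'"
      using eventually_gt_at_top[of 0] by eventually_elim (rule bound)
  qed
  have B_lim: "(B \<longlongrightarrow> B') at_top"
  proof (rule tendsto_sandwich[OF _ _ K_lim tendsto_const])
    show "\<forall>\<^sub>F Bi in at_top. B' - K / Bi \<le> B Bi"
      using eventually_gt_at_top[of 0] by eventually_elim (use bound sum1 in force)
    show "\<forall>\<^sub>F Bi in at_top. B Bi \<le> B'"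
      using eventually_gt_at_top[of 0] by eventually_elim (rule bound)
  qed
  show ?thesis
  proof (intro allI impI conjI)
    fix t x :: real assume t: "t > 0" and x: "0 < x \<and> x < s2inf t"
    have "((\<lambda>Bi. sqrt (2 * Ste * A Bi) * sqrt (a * t)) \<longlongrightarrow> s2inf t) at_top"
      unfolding s2inf[OF t] by (intro tendsto_intros A_lim)
    moreover have "\<forall>\<^sub>F Bi in at_top. sqrt (2 * Ste * A Bi) * sqrt (a * t) = s2 Bi t"
      using eventually_gt_at_top[of 0] by eventually_elim (use s2 t in simp)
    ultimately show s_lim: "((\<lambda>Bi. s2 Bi t) \<longlongrightarrow> s2inf t) at_top"
      by (rule Lim_transform_eventually)
    have "((\<lambda>Bi. - A Bi * \<Theta> * (1 - x / s2 Bi t) - B Bi * \<Theta> * (1 - x / s2 Bi t)\<^sup>2) \<longlongrightarrow> T2inf x t) at_top"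
    proof -
      have "T2inf x t = - A' * \<Theta> * (1 - x / s2inf t) - B' * \<Theta> * (1 - x / s2inf t)\<^sup>2"
        using T2inf[OF t] x by simp
      then show ?thesis using x by (auto intro!: tendsto_intros A_lim B_lim s_lim)
    qed
    \<comment> \<open>The profile formula for \<open>T2\<close> is available only up to the moving
      front \<open>s2 Bi t\<close>; as the fronts converge, the fixed \<open>x < s2inf t\<close>
      lies behind them for all large \<open>Bi\<close>.\<close>
    moreover have "\<forall>\<^sub>F Bi in at_top. x < s2 Bi t"
      using order_tendstoD(1)[OF s_lim] x by blast
    then have "\<forall>\<^sub>F Bi in at_top.
        - A Bi * \<Theta> * (1 - x / s2 Bi t) - B Bi * \<Theta> * (1 - x / s2 Bi t)\<^sup>2 = T2 Bi x t"
      using eventually_gt_at_top[of 0] by eventually_elim (use T2 t x in simp)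
    ultimately show "((\<lambda>Bi. T2 Bi x t) \<longlongrightarrow> T2inf x t) at_top"
      by (rule Lim_transform_eventually)
  qed
qed

end
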